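(* Let $f=\sum_{j\in J}a_jx^j\in\mathbb{F}_q[x_1,\dots,x_n]$, where $J\subset\mathbb{N}^n$ is finite and $a_j\in\mathbb{F}_q^\times$ for all $j\in J$, and suppose $f$ is not a polynomial in some proper subset of $\{x_1,\dots,x_n\}$. Let $N(f)$ be the number of solutions of $f=0$ with coordinates in $\mathbb{F}_q$. Let $J'=\{(j,1)\in\mathbb{N}^{n+1}\mid j\in J\}$ and let $\Delta(J')$ be the convex hull of $J'\cup\{(0,\dots,0)\}$ in $\mathbb{R}^{n+1}$. Let $\mu$ be the smallest positive integer such that $\mu\Delta(J')$, the dilation of $\Delta(J')$ by the factor $\mu$, contains a point of $M_{J'}\cap(\mathbb{N}_+)^{n+1}$. Then $\operatorname{ord}_q N(f)\geq\mu-1$.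
   Context: $p$ is a prime, $q$ is a power of $p$, $\mathbb{F}_q$ is the field with $q$ elements. $\mathbb{N}$ denotes the nonnegative integers and $\mathbb{N}_+$ the positive integers. For a finite set $S\subset\mathbb{Z}^m$, $\mathbb{Z}\langle S\rangle$ is the subgroup of $\mathbb{Z}^m$ generated by $S$, and $M_S=\{u\in\mathbb{Z}^m\mid ku\in\mathbb{Z}\langle S\rangle\text{ for some }k\in\mathbb{Z}\text{ with }(k,p)=1\}$ is its prime-to-$p$ saturation; here $M_{J'}$ is formed with $m=n+1$. $\operatorname{ord}_q$ is the $p$-adic valuation normalized by $\operatorname{ord}_q q=1$ (with $\operatorname{ord}_q 0=\infty$). *)

theory Defs
  imports
    "HOL-Analysis.Analysis"
    "HOL-Library.Poly_Mapping"
    "HOL-Library.Extended_Real"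
    "HOL-Computational_Algebra.Primes"
    "HOL-Computational_Algebra.Group_Closure"
begin

text \<open>
  Polynomials in the variables \<open>x\<^sub>i\<close> (\<open>i :: 'n\<close>, so the number of variables is \<open>CARD('n)\<close>) with
  coefficients in \<open>'a\<close>: an exponent vector has type \<open>'n \<Rightarrow>\<^sub>0 nat\<close>, a polynomial is a finitely
  supported assignment of coefficients to exponent vectors, and \<open>Poly_Mapping.keys f\<close> is the set
  of exponents of the monomials that occur in \<open>f\<close>.
\<close>

type_synonym ('n, 'a) mpolynomial = "('n \<Rightarrow>\<^sub>0 nat) \<Rightarrow>\<^sub>0 'a"

definition poly_eval :: "('n::finite, 'a::comm_semiring_1) mpolynomial \<Rightarrow> 'a ^ 'n \<Rightarrow> 'a" where
  "poly_eval f x =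
    (\<Sum>j\<in>Poly_Mapping.keys f. Poly_Mapping.lookup f j * (\<Prod>i\<in>UNIV. (x $ i) ^ Poly_Mapping.lookup j i))"

definition polys_in :: "'n set \<Rightarrow> ('n, 'a::zero) mpolynomial set" where
  "polys_in V = {f. \<forall>j\<in>Poly_Mapping.keys f. Poly_Mapping.keys j \<subseteq> V}"

definition num_zeros :: "('n::finite, 'a::comm_semiring_1) mpolynomial \<Rightarrow> nat" where
  "num_zeros f = card {x :: 'a ^ 'n. poly_eval f x = 0}"

definition prime_to_p_saturation :: "nat \<Rightarrow> (int ^ 'm) set \<Rightarrow> (int ^ 'm::finite) set" where
  "prime_to_p_saturation p S = {u. \<exists>k::int. coprime k (int p) \<and> k *s u \<in> group_closure S}"

definition real_vec :: "int ^ 'm \<Rightarrow> real ^ 'm::finite" where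
  "real_vec u = (\<chi> i. real_of_int (u $ i))"

definition newton_polytope :: "(int ^ 'm) set \<Rightarrow> (real ^ 'm::finite) set" where
  "newton_polytope S = convex hull (real_vec ` S \<union> {0})"

text \<open>
  The vector \<open>(j, 1)\<close>. The index type \<open>'n option\<close> has \<open>CARD('n) + 1\<close> elements, and \<open>None\<close> indexes
  the additional coordinate.
\<close>

definition append_one :: "('n \<Rightarrow>\<^sub>0 nat) \<Rightarrow> int ^ ('n::finite) option" where
  "append_one j = (\<chi> i. case i of None \<Rightarrow> 1 | Some k \<Rightarrow> int (Poly_Mapping.lookup j k))"

definition least_dilation :: "nat \<Rightarrow> (int ^ 'm::finite) set \<Rightarrow> nat" where
  "least_dilation p S =
    (LEAST \<mu>. 0 < \<mu> \<and>
      (\<exists>u \<in> prime_to_p_saturation p S. (\<forall>i. 0 < u $ i) \<and>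
        real_vec u \<in> (\<lambda>v. real \<mu> *\<^sub>R v) ` newton_polytope S))"

text \<open>
  The valuation at the prime \<open>p\<close>, normalized to take the value 1 at the power \<open>q\<close> of \<open>p\<close>
  (with \<open>q \<noteq> 1\<close>).
\<close>

definition ord_norm :: "nat \<Rightarrow> nat \<Rightarrow> nat \<Rightarrow> ereal" where
  "ord_norm p q x =
    (if x = 0 then \<infinity> else ereal (real (multiplicity p x) / real (multiplicity p q)))"

end

theory Submission
  imports
    "HOL-Algebra.Multiplicative_Group"
    "HOL-Number_Theory.Cong"
    Defs
begin

text \<open>
  Write \<open>N\<close> for the number of zeros of \<open>f\<close>, \<open>\<mu>\<close> for the least dilation and \<open>k = e (\<mu> - 1)\<close>; the claim is
  that \<open>p\<^sup>k\<close> divides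
  \<open>N\<close>. No characters or Gauss sums are needed.

  Choose a ring \<open>R\<close> of characteristic zero with a decreasing chain of ideals \<open>I k\<close> that behave like
  powers of a maximal ideal containing \<open>p\<close>, with \<open>R / I 1\<close> the field \<open>F\<close> of \<open>q = p\<^sup>e\<close> elements and
  \<open>I k \<inter> \<int> = p\<^sup>k\<int>\<close> (locale \<open>adic_lift\<close>, lemma \<open>adic_lift_exists\<close>). Modulo \<open>I k\<close>, taking a high power of
  any lift gives a multiplicative section \<open>T\<close> of \<open>R \<rightarrow> F\<close>. If \<open>G\<close> lifts \<open>f\<close> and
  \<open>M = (q - 1) p\<^sup>k\<close>, then \<open>G(T x)\<^sup>M\<close> is congruent to 0 or 1 according to whether \<open>f x\<close> vanishes, so
  that \<open>N\<close> is congruent to the sum of \<open>1 - G(T x)\<^sup>M\<close> over all points \<open>x\<close>. Expand by the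
  multinomial theorem. The power sum of \<open>(T a)\<^sup>u\<close> over \<open>a \<in> F\<close> vanishes modulo \<open>I k\<close> unless
  \<open>q - 1\<close> divides \<open>u\<close>, and equals \<open>q\<close> when \<open>u = 0\<close>. Hence only those exponent families
  \<open>(m\<^sub>j)\<close> of total \<open>M\<close> contribute for which \<open>q - 1\<close> divides every coordinate of \<open>\<Sum> m\<^sub>j j\<close>, and such
  a family contributes a multiple of the multinomial coefficient times \<open>q\<^sup>z\<close>, where \<open>z\<close> is the
  number of coordinates of \<open>\<Sum> m\<^sub>j j\<close> that are zero (lemma \<open>num_zeros_dvd\<close>).

  By Legendre's formula the multinomial coefficient has \<open>p\<close>-adic valuation
  \<open>(\<Sum> s(m\<^sub>j)) / (p - 1) - e\<close>, where \<open>s\<close> is the sum of the digits in base \<open>p\<close>. Shifting digit positions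
  cyclically modulo \<open>e\<close> turns \<open>m\<^sub>j\<close> into \<open>e\<close> weights \<open>\<sigma>\<^sub>i(m\<^sub>j) \<equiv> p\<^sup>i m\<^sub>j\<close> modulo \<open>q - 1\<close>, with sum
  \<open>s(m\<^sub>j) (q - 1) / (p - 1)\<close> over \<open>i\<close>. For each \<open>i\<close> the vector \<open>\<Sum> \<sigma>\<^sub>i(m\<^sub>j) (j, 1) / (q - 1)\<close> is
  integral and lies in the prime-to-\<open>p\<close> saturation, and adding one suitable generator \<open>(j, 1)\<close> for
  each of its \<open>z\<close> zero coordinates makes it positive. So its last coordinate, which is the dilation
  factor, is at least \<open>\<mu> - z\<close> (lemma \<open>least_dilation_le_add_zeros\<close>). Summing over \<open>i\<close> shows that the
  multinomial coefficient times \<open>q\<^sup>z\<close> is divisible by \<open>p\<^sup>k\<close> (lemma \<open>multinomial_divisible\<close>).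
\<close>

section \<open>Base-p digits and Legendre's formula\<close>

text \<open>
  The sum of the digits of \<open>m\<close> in base \<open>p\<close>. It is set to 0 when \<open>p < 2\<close>, where base \<open>p\<close> makes no
  sense and the recursion would not terminate.
\<close>

function digit_sum :: "nat \<Rightarrow> nat \<Rightarrow> nat" where
  "digit_sum p m = (if p < 2 \<or> m = 0 then 0 else m mod p + digit_sum p (m div p))"
  by pat_completeness auto
termination by (relation "Wellfounded.measure snd") auto

text \<open>
  Reads the base-\<open>p\<close> digits of \<open>m\<close> and puts the digit at position \<open>r\<close> at position \<open>(i + r) mod e\<close>,
  adding the digits that meet there; 0 when \<open>p < 2\<close>. Modulo \<open>p\<^sup>e - 1\<close> the
  result is \<open>p\<^sup>i m\<close>, because \<open>p\<^sup>e\<close> is 1 there.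
\<close>

function cyclic_digits :: "nat \<Rightarrow> nat \<Rightarrow> nat \<Rightarrow> nat \<Rightarrow> nat" where
  "cyclic_digits p e i m =
    (if p < 2 \<or> m = 0 then 0
     else (m mod p) * p ^ (i mod e) + cyclic_digits p e (Suc i) (m div p))"
  by pat_completeness auto
termination by (relation "Wellfounded.measure (\<lambda>(p, e, i, m). m)") auto

declare digit_sum.simps [simp del] cyclic_digits.simps [simp del]

lemma digit_sum_0 [simp]: "digit_sum p 0 = 0"
  by (simp add: digit_sum.simps)

lemma cyclic_digits_0 [simp]: "cyclic_digits p e i 0 = 0"
  by (simp add: cyclic_digits.simps)

lemma digit_sum_split:
  assumes "r < p" "p \<ge> 2"
  shows "digit_sum p (p * m + r) = digit_sum p m + r"
  using assms by (cases "p * m + r = 0") (auto simp: digit_sum.simps[of p "p * m + r"])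

lemma digit_sum_power_minus_1:
  assumes "p \<ge> 2"
  shows "digit_sum p (p ^ e - 1) = e * (p - 1)"
proof (induction e)
  case (Suc e)
  have "p ^ Suc e - 1 = p * (p ^ e - 1) + (p - 1)"
    using assms by (simp add: diff_mult_distrib2)
  then have "digit_sum p (p ^ Suc e - 1) = digit_sum p (p ^ e - 1) + (p - 1)"
    using digit_sum_split[of "p - 1" p "p ^ e - 1"] assms by (simp only:)
  then show ?case
    using Suc by (simp only: mult_Suc add.commute)
qed simp

lemma digit_sum_mult_power:
  assumes "p \<ge> 2"
  shows "digit_sum p (m * p ^ k) = digit_sum p m"
proof (induction k)
  case (Suc k)
  then show ?case
    using digit_sum_split[of 0 p "m * p ^ k"] assms by (simp add: mult_ac)
qed simp

text \<open>
  Adding 1 turns the trailing digits \<open>p - 1\<close>, of which there are \<open>multiplicity p (Suc n)\<close>, into 0.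
\<close>

lemma digit_sum_Suc:
  assumes "prime p"
  shows "digit_sum p (Suc n) + (p - 1) * multiplicity p (Suc n) = Suc (digit_sum p n)"
proof (induction n rule: less_induct)
  case (less n)
  have p: "p \<ge> 2" using assms by (rule prime_ge_2_nat)
  define t r where "t = n div p" and "r = n mod p"
  have n: "n = p * t + r" and r: "r < p" using p by (auto simp: t_def r_def)
  show ?case
  proof (cases "Suc r < p")
    case True
    have s: "Suc n = p * t + Suc r" using n by simp
    have "\<not> p dvd Suc n"
      unfolding s using True nat_dvd_not_less[of "Suc r" p] dvd_add_right_iff[of p "p * t" "Suc r"] by simp
    then have "multiplicity p (Suc n) = 0" by (rule not_dvd_imp_multiplicity_0)
    then show ?thesis
      using digit_sum_split[OF r p, of t] digit_sum_split[OF True p, of t] by (simp only: s n[symmetric])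
  next
    case False
    then have r': "r = p - 1" using r by simp
    have s: "Suc n = p * Suc t" using n r' p by simp
    have m: "multiplicity p (Suc n) = Suc (multiplicity p (Suc t))"
      unfolding s using assms p by (subst multiplicity_times_same) auto
    have "1 * t \<le> p * t" using p by (intro mult_le_mono1) simp
    then have "t < n"
      using n r' p by linarith
    then have IH: "digit_sum p (Suc t) + (p - 1) * multiplicity p (Suc t) = Suc (digit_sum p t)"
      by (rule less)
    have "digit_sum p (Suc n) = digit_sum p (Suc t)"
      unfolding s using digit_sum_split[of 0 p "Suc t"] p by simp
    moreover have "digit_sum p n = digit_sum p t + (p - 1)"
      using digit_sum_split[OF r p, of t] n r' by simp
    ultimately show ?thesis using IH m by simp
  qed
qed

lemma legendre_multiplicity_fact:
  assumes "prime p"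
  shows "(p - 1) * multiplicity p (fact n :: nat) + digit_sum p n = n"
proof (induction n)
  case (Suc n)
  have "multiplicity p (fact (Suc n) :: nat) = multiplicity p (Suc n) + multiplicity p (fact n :: nat)"
    unfolding fact_Suc using assms by (subst prime_elem_multiplicity_mult_distrib) auto
  then show ?case
    using Suc digit_sum_Suc[OF assms, of n] by (simp add: distrib_left)
qed simp

lemma cyclic_digits_eq_0_iff:
  assumes "p \<ge> 2"
  shows "cyclic_digits p e i m = 0 \<longleftrightarrow> m = 0"
proof (induction m arbitrary: i rule: less_induct)
  case (less m)
  show ?case
  proof (cases "m = 0")
    case False
    then have "cyclic_digits p e (Suc i) (m div p) = 0 \<longleftrightarrow> m div p = 0"
      using assms by (intro less) simp
    moreover have "m mod p \<noteq> 0 \<or> m div p \<noteq> 0"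
      using False by (metis add.right_neutral mult_0_right mult_div_mod_eq)
    ultimately show ?thesis
      using False assms by (subst cyclic_digits.simps) auto
  qed simp
qed

lemma cong_power_mod_exponent:
  fixes p :: nat
  assumes "p > 0" 
  shows "[p ^ (i mod e) = p ^ i] (mod p ^ e - 1)"
proof -
  have "[p ^ e = 1] (mod p ^ e - 1)"
    using assms by (intro cong_le_nat[THEN iffD2] exI[of _ 1]) auto
  then have "[(p ^ e) ^ (i div e) * p ^ (i mod e) = 1 ^ (i div e) * p ^ (i mod e)] (mod p ^ e - 1)"
    by (intro cong_mult cong_pow cong_refl)
  then show ?thesis
    by (simp add: cong_sym flip: power_mult power_add)
qed

lemma cyclic_digits_cong:
  assumes "p \<ge> 2"
  shows "[cyclic_digits p e i m = p ^ i * m] (mod p ^ e - 1)"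
proof (induction m arbitrary: i rule: less_induct)
  case (less m)
  show ?case
  proof (cases "m = 0")
    case False
    then have "[cyclic_digits p e (Suc i) (m div p) = p ^ Suc i * (m div p)] (mod p ^ e - 1)"
      using assms by (intro less) simp
    moreover have "[(m mod p) * p ^ (i mod e) = (m mod p) * p ^ i] (mod p ^ e - 1)"
      using assms by (intro cong_mult cong_power_mod_exponent cong_refl) simp
    ultimately have "[(m mod p) * p ^ (i mod e) + cyclic_digits p e (Suc i) (m div p)
        = (m mod p) * p ^ i + p ^ Suc i * (m div p)] (mod p ^ e - 1)"
      by (rule cong_add[rotated])
    moreover have "(m mod p) * p ^ i + p ^ Suc i * (m div p) = p ^ i * (m mod p + p * (m div p))"
      by (simp only: distrib_left power_Suc mult_ac)
    ultimately show ?thesis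
      using False assms by (subst cyclic_digits.simps) (simp add: mult_div_mod_eq)
  qed simp
qed

lemma sum_power_mod_shift:
  fixes p :: nat
  assumes "e > 0"
  shows "(\<Sum>i<e. p ^ ((i + c) mod e)) = (\<Sum>i<e. p ^ i)"
proof (induction c)
  case (Suc c)
  obtain d where e: "e = Suc d" using assms by (cases e) auto
  have "(\<Sum>i<e. p ^ ((i + Suc c) mod e)) = (\<Sum>i<d. p ^ ((Suc i + c) mod e)) + p ^ (c mod e)"
    unfolding e by (simp add: mod_add_self1[of "Suc d" c, simplified])
  also have "\<dots> = (\<Sum>i<e. p ^ ((i + c) mod e))"
    unfolding e by (subst sum.lessThan_Suc_shift) simp
  finally show ?case using Suc by simp
qed simp

text \<open>
  As \<open>i\<close> runs through a full period, each digit visits every position below \<open>e\<close> once.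
\<close>

lemma sum_cyclic_digits:
  assumes "p \<ge> 2" "e > 0"
  shows "(\<Sum>i<e. cyclic_digits p e (i + c) m) = digit_sum p m * (\<Sum>i<e. p ^ i)"
proof (induction m arbitrary: c rule: less_induct)
  case (less m)
  show ?case
  proof (cases "m = 0")
    case False
    then have "(\<Sum>i<e. cyclic_digits p e (i + Suc c) (m div p))
        = digit_sum p (m div p) * (\<Sum>i<e. p ^ i)"
      using assms by (intro less) simp
    moreover have "(\<Sum>i<e. cyclic_digits p e (i + c) m)
       = (m mod p) * (\<Sum>i<e. p ^ ((i + c) mod e)) + (\<Sum>i<e. cyclic_digits p e (i + Suc c) (m div p))"
      using False assms
      by (subst cyclic_digits.simps) (simp add: sum.distrib sum_distrib_left)
    ultimately show ?thesis
      using False assms sum_power_mod_shift[OF assms(2), of p c]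
      by (simp add: digit_sum.simps[of p m] distrib_right)
  qed simp
qed

section \<open>The multinomial theorem\<close>

text \<open>
  The families of exponents indexed by \<open>J\<close> with total \<open>M\<close>. They are extensional (undefined outside
  \<open>J\<close>), so that each family is counted once.
\<close>

definition compositions :: "'j set \<Rightarrow> nat \<Rightarrow> ('j \<Rightarrow> nat) set" where
  "compositions J M = {m \<in> J \<rightarrow>\<^sub>E UNIV. sum m J = M}"

text \<open>
  The multinomial coefficient of the family \<open>m\<close> on \<open>J\<close>. The division is exact.
\<close>

definition multinomial :: "'j set \<Rightarrow> ('j \<Rightarrow> nat) \<Rightarrow> nat" where
  "multinomial J m = fact (sum m J) div (\<Prod>j\<in>J. fact (m j))"

lemma multinomial_mult_prod_fact:
  assumes "finite J"
  shows "multinomial J m * (\<Prod>j\<in>J. fact (m j)) = fact (sum m J)"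
proof -
  have "(\<Prod>j\<in>J. fact (m j)) dvd (fact (sum m J) :: nat)"
    using assms
  proof induction
    case (insert b K)
    have "fact (m b) * (\<Prod>j\<in>K. fact (m j)) dvd (fact (m b) * fact (sum m K) :: nat)"
      using insert by (intro mult_dvd_mono) auto
    also have "\<dots> dvd fact (sum m (insert b K))"
      using insert fact_fact_dvd_fact[of "m b" "sum m K"] by (simp add: add.commute)
    finally show ?case using insert by simp
  qed simp
  then show ?thesis
    unfolding multinomial_def by simp
qed

lemma multinomial_insert:
  assumes "finite J" "a \<notin> J"
  shows "multinomial (insert a J) m = (sum m (insert a J) choose m a) * multinomial J m"
proof -
  have "fact (sum m (insert a J)) = (sum m (insert a J) choose m a) * (fact (m a) * fact (sum m J))"
    using binomial_fact_lemma[of "m a" "sum m (insert a J)"] assms by (simp add: mult_ac)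
  also have "\<dots> = (sum m (insert a J) choose m a) * multinomial J m * (\<Prod>j\<in>insert a J. fact (m j))"
    using multinomial_mult_prod_fact[OF assms(1), of m, symmetric] assms by (simp add: mult_ac)
  finally show ?thesis
    unfolding multinomial_def[of "insert a J"] using assms by (simp del: prod.insert)
qed

lemma finite_compositions: "finite J \<Longrightarrow> finite (compositions J M)"
  by (rule finite_subset[of _ "J \<rightarrow>\<^sub>E {..M}"])
     (auto simp: compositions_def PiE_iff extensional_def intro: finite_PiE member_le_sum)

lemma multinomial_theorem:
  fixes z :: "'j \<Rightarrow> 'r::comm_ring_1"
  assumes "finite J"
  shows "(\<Sum>j\<in>J. z j) ^ M = (\<Sum>m\<in>compositions J M. of_nat (multinomial J m) * (\<Prod>j\<in>J. z j ^ m j))"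
  using assms
proof (induction J arbitrary: M)
  case empty
  show ?case
    by (cases "M = 0") (auto simp: compositions_def multinomial_def zero_power)
next
  case (insert a J)
  let ?t = "\<lambda>J m. of_nat (multinomial J m) * (\<Prod>j\<in>J. z j ^ m j)"
  have "(\<Sum>j\<in>insert a J. z j) ^ M = (\<Sum>k\<le>M. of_nat (M choose k) * z a ^ k * (\<Sum>j\<in>J. z j) ^ (M - k))"
    using insert by (simp add: binomial_ring)
  also have "\<dots> = (\<Sum>k\<le>M. \<Sum>m\<in>compositions J (M - k). of_nat (M choose k) * z a ^ k * ?t J m)"
    by (simp add: insert.IH sum_distrib_left)
  also have "\<dots> = (\<Sum>(k, m)\<in>(SIGMA k:{..M}. compositions J (M - k)). of_nat (M choose k) * z a ^ k * ?t J m)"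
    using insert by (subst sum.Sigma) (auto intro: finite_compositions)
  also have "\<dots> = (\<Sum>m\<in>compositions (insert a J) M. ?t (insert a J) m)"
  proof (rule sum.reindex_bij_witness[of _ "\<lambda>m. (m a, m(a := undefined))" "\<lambda>(k, m). m(a := k)"], goal_cases)
    case (1 y)
    then show ?case using insert by (auto simp: compositions_def PiE_iff extensional_def fun_eq_iff)
  next
    case (2 y)
    obtain k m where y: "y = (k, m)" by force
    have "sum (m(a := k)) J = sum m J"
      using insert by (intro sum.cong) auto
    then have "sum (m(a := k)) (insert a J) = k + sum m J"
      using insert by simp
    then show ?case
      using 2 by (auto simp: y compositions_def PiE_iff extensional_def simp del: sum.insert)
  next
    case (3 m)
    then show ?case by auto
  next
    case (4 m)
    have "sum (m(a := undefined)) J = sum m J"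
      using insert by (intro sum.cong) auto
    then show ?case
      using 4 insert by (auto simp: compositions_def PiE_iff extensional_def)
  next
    case (5 y)
    obtain k m where y: "y = (k, m)" by force
    have m: "k \<le> M" "sum m J = M - k" using 5 y by (auto simp: compositions_def)
    have s: "sum (m(a := k)) J = sum m J" "(\<Prod>j\<in>J. z j ^ (m(a := k)) j) = (\<Prod>j\<in>J. z j ^ m j)"
        "(\<Prod>j\<in>J. fact ((m(a := k)) j)) = (\<Prod>j\<in>J. fact (m j) :: nat)"
      using insert by (auto intro!: sum.cong prod.cong)
    then have "multinomial J (m(a := k)) = multinomial J m"
      by (simp only: multinomial_def)
    then show ?case
      using insert m by (simp add: y multinomial_insert s mult_ac del: fun_upd_apply) (simp add: mult_ac)
  qed
  finally show ?case .
qed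

text \<open>
  This sums Legendre's formula over the factorials in the multinomial coefficient; it is stated
  additively to avoid truncated subtraction.
\<close>

lemma multinomial_multiplicity:
  assumes "prime p" "finite J"
  shows "(p - 1) * multiplicity p (multinomial J m) + digit_sum p (sum m J) = (\<Sum>j\<in>J. digit_sum p (m j))"
proof -
  have prod: "multinomial J m * (\<Prod>j\<in>J. fact (m j)) = fact (sum m J)"
    using assms by (intro multinomial_mult_prod_fact)
  then have "multinomial J m \<noteq> 0"
    by (metis fact_nonzero mult_zero_left)
  then have "multiplicity p (fact (sum m J) :: nat)
      = multiplicity p (multinomial J m) + (\<Sum>j\<in>J. multiplicity p (fact (m j) :: nat))"
    using assms unfolding prod[symmetric]
    by (subst prime_elem_multiplicity_mult_distrib)
       (auto simp: prime_elem_multiplicity_prod_distrib image_iff)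
  then have "(p - 1) * multiplicity p (fact (sum m J) :: nat)
      = (p - 1) * multiplicity p (multinomial J m) + (\<Sum>j\<in>J. (p - 1) * multiplicity p (fact (m j) :: nat))"
    by (simp only: distrib_left sum_distrib_left)
  moreover have "(\<Sum>j\<in>J. (p - 1) * multiplicity p (fact (m j) :: nat)) + (\<Sum>j\<in>J. digit_sum p (m j)) = sum m J"
    by (simp only: sum.distrib[symmetric] legendre_multiplicity_fact[OF assms(1)])
  ultimately show ?thesis
    using legendre_multiplicity_fact[OF assms(1), of "sum m J"] by linarith
qed

section \<open>Points of the dilated polytope from integral weights\<close>

text \<open>
  If \<open>\<Sum> w\<^sub>j (j, 1)\<close> has positive coordinates divisible by \<open>d\<close>, then its quotient by \<open>d\<close> competes in
  the definition of the least dilation, with dilation factor \<open>\<Sum> w\<^sub>j / d\<close>.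
\<close>

lemma least_dilation_le:
  fixes J :: "('n::finite \<Rightarrow>\<^sub>0 nat) set" and w :: "('n \<Rightarrow>\<^sub>0 nat) \<Rightarrow> nat"
  assumes J: "finite J" and d: "d > 0" "coprime d p"
    and total: "d dvd sum w J" "sum w J > 0"
    and coords: "\<And>c. d dvd (\<Sum>j\<in>J. w j * Poly_Mapping.lookup j c)"
      "\<And>c. 0 < (\<Sum>j\<in>J. w j * Poly_Mapping.lookup j c)"
  shows "d * least_dilation p (append_one ` J) \<le> sum w J"
proof -
  obtain t where t: "sum w J = d * t" using total by auto
  have t0: "t > 0" using t total by (cases t) auto
  define u :: "int ^ 'n option" where
    "u = (\<chi> i. int ((\<Sum>j\<in>J. w j * (case i of None \<Rightarrow> 1 | Some k \<Rightarrow> Poly_Mapping.lookup j k)) div d))"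
  have dvd: "d dvd (\<Sum>j\<in>J. w j * (case i of None \<Rightarrow> 1 | Some k \<Rightarrow> Poly_Mapping.lookup j k))" for i
    using total coords by (cases i) auto
  have du: "int d * u $ i = (\<Sum>j\<in>J. int (w j) * append_one j $ i)" for i
  proof -
    have "int d * u $ i = int (\<Sum>j\<in>J. w j * (case i of None \<Rightarrow> 1 | Some k \<Rightarrow> Poly_Mapping.lookup j k))"
      using dvd[of i] by (simp add: u_def flip: of_nat_mult)
    also have "\<dots> = (\<Sum>j\<in>J. int (w j) * append_one j $ i)"
      by (cases i) (simp_all add: append_one_def)
    finally show ?thesis .
  qed
  have mult_closure: "int n *s v \<in> group_closure S" if "v \<in> group_closure S" for n v and S :: "(int ^ 'n option) set"
  proof (induction n)
    case 0
    have "int 0 *s v = 0" by (simp add: vec_eq_iff)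
    then show ?case by (metis zero_in_group_closure)
  next
    case (Suc n)
    have "int (Suc n) *s v = v + int n *s v" by (simp add: vec_eq_iff algebra_simps)
    then show ?case using Suc that by (metis group_closure_add)
  qed
  have sum_closure: "(\<Sum>j\<in>K. int (w j) *s append_one j) \<in> group_closure (append_one ` J)"
    if "K \<subseteq> J" for K
    using finite_subset[OF that J] that
  proof induction
    case (insert j K)
    have "int (w j) *s append_one j \<in> group_closure (append_one ` J)"
      using insert by (intro mult_closure group_closure.base) simp
    moreover have "(\<Sum>j\<in>K. int (w j) *s append_one j) \<in> group_closure (append_one ` J)"
      using insert by simp
    ultimately show ?case
      unfolding sum.insert[OF insert.hyps] by (rule group_closure_add)
  qed simp
  have "int d *s u = (\<Sum>j\<in>J. int (w j) *s append_one j)"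
    by (simp add: vec_eq_iff du)
  then have mem: "u \<in> prime_to_p_saturation p (append_one ` J)"
    using sum_closure[of J] d by (auto simp: prime_to_p_saturation_def intro!: exI[of _ "int d"])
  have pos: "0 < u $ i" for i
  proof -
    have "0 < (\<Sum>j\<in>J. w j * (case i of None \<Rightarrow> 1 | Some k \<Rightarrow> Poly_Mapping.lookup j k))"
      using total coords by (cases i) auto
    then show ?thesis
      using dvd[of i] d by (auto simp: u_def div_greater_zero_iff intro!: dvd_imp_le)
  qed
  \<comment> \<open>The weights divided by their sum \<open>d t\<close> are the coefficients of a convex combination.\<close>
  define v where "v = (\<Sum>j\<in>J. (real (w j) / real (d * t)) *\<^sub>R real_vec (append_one j :: int ^ 'n option))"
  have "v \<in> newton_polytope (append_one ` J)"
    unfolding v_def newton_polytope_def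
    using d t0 t J
    by (intro convex_sum)
       (auto intro!: hull_inc simp flip: sum_divide_distrib of_nat_sum)
  moreover have "real_vec u = real t *\<^sub>R v"
  proof -
    have "real_vec u $ i = (real t *\<^sub>R v) $ i" for i
    proof -
      have "real d * real_vec u $ i = real_of_int (int d * u $ i)"
        by (simp add: real_vec_def)
      also have "\<dots> = (\<Sum>j\<in>J. real (w j) * real_of_int (append_one j $ i))"
        unfolding du by simp
      also have "\<dots> = real d * (real t *\<^sub>R v) $ i"
        using d t0 by (simp add: v_def real_vec_def sum_distrib_left)
      finally show ?thesis using d by simp
    qed
    then show ?thesis by (simp add: vec_eq_iff)
  qed
  ultimately have "least_dilation p (append_one ` J) \<le> t"
    unfolding least_dilation_def using t0 mem pos
    by (intro Least_le) blast
  then show ?thesis using t by simp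
qed

text \<open>
  A coordinate \<open>c\<close> at which the weighted sum vanishes is made positive by raising by \<open>d\<close> the weight
  of one exponent vector in which the variable \<open>c\<close> occurs.
\<close>

lemma least_dilation_le_add_zeros:
  fixes J :: "('n::finite \<Rightarrow>\<^sub>0 nat) set" and w :: "('n \<Rightarrow>\<^sub>0 nat) \<Rightarrow> nat"
  assumes J: "finite J" and d: "d > 0" "coprime d p"
    and occurs: "\<And>c. \<exists>j\<in>J. Poly_Mapping.lookup j c > 0"
    and total: "d dvd sum w J"
    and coords: "\<And>c. d dvd (\<Sum>j\<in>J. w j * Poly_Mapping.lookup j c)"
  shows "d * least_dilation p (append_one ` J)
    \<le> sum w J + d * card {c. (\<Sum>j\<in>J. w j * Poly_Mapping.lookup j c) = 0}"
proof -
  define Z where "Z = {c. (\<Sum>j\<in>J. w j * Poly_Mapping.lookup j c) = 0}"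
  obtain s where s: "\<And>c. s c \<in> J" "\<And>c. Poly_Mapping.lookup (s c) c > 0"
    using occurs by metis
  define w' where "w' j = w j + d * card {c\<in>Z. s c = j}" for j
  have sum_w': "(\<Sum>j\<in>J. w' j * g j) = (\<Sum>j\<in>J. w j * g j) + d * (\<Sum>c\<in>Z. g (s c))" for g
  proof -
    have "(\<Sum>c\<in>Z. g (s c)) = (\<Sum>j\<in>J. \<Sum>c\<in>{c\<in>Z. s c = j}. g (s c))"
      using J s by (intro sum.group[symmetric]) auto
    also have "\<dots> = (\<Sum>j\<in>J. card {c\<in>Z. s c = j} * g j)"
      by (intro sum.cong) auto
    finally have "d * (\<Sum>c\<in>Z. g (s c)) = (\<Sum>j\<in>J. d * card {c\<in>Z. s c = j} * g j)"
      by (simp add: sum_distrib_left mult.assoc)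
    then show ?thesis
      by (simp add: w'_def distrib_right sum.distrib)
  qed
  have total': "sum w' J = sum w J + d * card Z"
    using sum_w'[of "\<lambda>_. 1"] by simp
  have pos: "0 < (\<Sum>j\<in>J. w' j * Poly_Mapping.lookup j c)" for c
  proof (cases "c \<in> Z")
    case True
    then have "Poly_Mapping.lookup (s c) c \<le> (\<Sum>c'\<in>Z. Poly_Mapping.lookup (s c') c)"
      by (intro member_le_sum) auto
    then show ?thesis unfolding sum_w' using s(2)[of c] d by simp
  next
    case False
    then show ?thesis unfolding sum_w' Z_def by simp
  qed
  have "d * least_dilation p (append_one ` J) \<le> sum w' J"
  proof (rule least_dilation_le[OF J d _ _ _ pos])
    show "d dvd sum w' J" using total total' by simp
    show "d dvd (\<Sum>j\<in>J. w' j * Poly_Mapping.lookup j c)" for c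
      unfolding sum_w' using coords by simp
    \<comment> \<open>There is at least one coordinate, since index types are nonempty.\<close>
    have "sum w' J \<noteq> 0"
    proof
      assume "sum w' J = 0"
      then have "\<forall>j\<in>J. w' j = 0" using J by simp
      then show False using pos[of undefined] by simp
    qed
    then show "0 < sum w' J" by simp
  qed
  then show ?thesis using total' Z_def by simp
qed

section \<open>Finite fields\<close>

lemma finite_field_has_generator:
  "\<exists>g::'a::{field,finite}. g \<noteq> 0 \<and> (\<forall>x. x \<noteq> 0 \<longrightarrow> (\<exists>i::nat. x = g ^ i))"
proof -
  define R :: "'a ring" where
    "R = \<lparr>carrier = UNIV, monoid.mult = (*), one = 1, ring.zero = 0, add = (+)\<rparr>"
  have "\<exists>y. x + y = 0" for x :: 'a by (rule exI[of _ "- x"]) simp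
  moreover have "x \<noteq> 0 \<Longrightarrow> \<exists>y. x * y = 1" for x :: 'a by (rule exI[of _ "inverse x"]) simp
  ultimately interpret R: Ring.field R
    by unfold_locales (auto simp: R_def algebra_simps Units_def)
  have carrier: "carrier (mult_of R) = - {0}"
    by (auto simp: R_def mult_of_def)
  have pow: "x [^]\<^bsub>R\<^esub> (i::nat) = x ^ i" for x i
    by (induction i) (simp_all add: R_def mult_of_def nat_pow_def mult.commute)
  have "finite (carrier R)" by simp
  from R.finite_field_mult_group_has_gen[OF this] obtain g where
    g: "g \<in> carrier (mult_of R)" "carrier (mult_of R) = {g [^]\<^bsub>R\<^esub> i | i::nat. i \<in> UNIV}"
    by (elim bexE)
  have "\<exists>i::nat. x = g ^ i" if "x \<noteq> 0" for x
  proof -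
    have "x \<in> - {0}" using that by simp
    then show ?thesis using g(2) unfolding carrier by (auto simp: pow)
  qed
  moreover have "g \<noteq> 0" using g(1) unfolding carrier by simp
  ultimately show ?thesis by blast
qed

lemma finite_field_power_card_minus_1:
  fixes x :: "'a::{field,finite}"
  assumes "x \<noteq> 0"
  shows "x ^ (CARD('a) - 1) = 1"
proof -
  have "bij_betw (\<lambda>y. x * y) (- {0}) (- {0})"
    by (rule bij_betw_byWitness[of _ "\<lambda>y. y / x"]) (use assms in auto)
  then have "(\<Prod>y\<in>-{0}. x * y) = \<Prod>(- {0})"
    by (rule prod.reindex_bij_betw)
  moreover have "(\<Prod>y\<in>-{0}. x * y) = x ^ card (- {0::'a}) * \<Prod>(- {0})"
    by (simp add: prod.distrib)
  moreover have "\<Prod>(- {0::'a}) \<noteq> 0" by simp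
  ultimately have "x ^ card (- {0::'a}) = 1" by simp
  moreover have "card (- {0::'a}) = CARD('a) - 1"
    by (simp add: Compl_eq_Diff_UNIV card_Diff_subset)
  ultimately show ?thesis by simp
qed

lemma finite_field_power_card:
  fixes x :: "'a::{field,finite}"
  shows "x ^ CARD('a) = x"
proof (cases "x = 0")
  case False
  then show ?thesis
    using power_minus_mult[of "CARD('a)" x] finite_field_power_card_minus_1[of x] by simp
qed simp

lemma generator_power_eq_1_imp_dvd:
  fixes g :: "'a::{field,finite}"
  assumes g: "g \<noteq> 0" "\<And>x. x \<noteq> 0 \<Longrightarrow> \<exists>i::nat. x = g ^ i" and u: "g ^ u = 1"
  shows "CARD('a) - 1 dvd u"
proof (rule ccontr)
  assume nd: "\<not> CARD('a) - 1 dvd u"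
  define r where "r = u mod (CARD('a) - 1)"
  have c: "CARD('a) > 1" using card_mono[of "UNIV :: 'a set" "{0,1}"] by simp
  have r: "0 < r" "r < CARD('a) - 1" using nd c by (auto simp: r_def dvd_eq_mod_eq_0)
  have "g ^ (CARD('a) - 1) = 1" using g(1) by (rule finite_field_power_card_minus_1)
  then have "g ^ ((CARD('a) - 1) * (u div (CARD('a) - 1)) + r) = g ^ r"
    by (simp only: power_add power_mult power_one mult_1)
  then have gr: "g ^ r = 1" using u by (simp add: r_def)
  \<comment> \<open>The powers of \<open>g\<close> now repeat with period \<open>r\<close>, so they cannot exhaust the nonzero elements.\<close>
  have "- {0} \<subseteq> (\<lambda>i. g ^ i) ` {..<r}"
  proof
    fix x assume "x \<in> - {0::'a}"
    then obtain i where i: "x = g ^ i" using g(2) by auto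
    have "g ^ (r * (i div r) + i mod r) = g ^ (i mod r)"
      by (simp only: power_add power_mult power_one mult_1 gr)
    then have "x = g ^ (i mod r)" by (simp add: i)
    then show "x \<in> (\<lambda>i. g ^ i) ` {..<r}" using r by auto
  qed
  then have "card (- {0::'a}) \<le> r"
    by (metis card_lessThan finite_lessThan surj_card_le)
  moreover have "card (- {0::'a}) = CARD('a) - 1"
    by (simp add: Compl_eq_Diff_UNIV card_Diff_subset)
  ultimately show False using r by simp
qed

section \<open>A lift of a finite field to characteristic zero\<close>

text \<open>
  The value at \<open>\<theta>\<close> of a polynomial with integer coefficients.
\<close>

definition poly_at :: "'a::comm_ring_1 \<Rightarrow> int poly \<Rightarrow> 'a" where
  "poly_at \<theta> f = poly (map_poly of_int f) \<theta>"

lemma poly_at_simps [simp]: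
  "poly_at \<theta> 0 = 0"
  "poly_at \<theta> 1 = 1"
  "poly_at \<theta> (pCons c f) = of_int c + \<theta> * poly_at \<theta> f"
  by (simp_all add: poly_at_def map_poly_pCons)

lemma poly_at_add [simp]: "poly_at \<theta> (f + g) = poly_at \<theta> f + poly_at \<theta> g"
  by (induction f g rule: poly_induct2) (simp_all add: algebra_simps)

lemma poly_at_smult [simp]: "poly_at \<theta> (smult c f) = of_int c * poly_at \<theta> f"
  by (induction f) (simp_all add: algebra_simps)

lemma poly_at_mult [simp]: "poly_at \<theta> (f * g) = poly_at \<theta> f * poly_at \<theta> g"
  by (induction f) (simp_all add: algebra_simps)

lemma poly_at_monom [simp]: "poly_at \<theta> (monom c n) = of_int c * \<theta> ^ n"
  by (induction n) (simp_all add: monom_0 monom_Suc algebra_simps)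

lemma poly_at_diff [simp]: "poly_at \<theta> (f - g) = poly_at \<theta> f - poly_at \<theta> g"
  using poly_at_add[of \<theta> "f - g" g] by (simp del: poly_at_add)

text \<open>
  A commutative ring \<open>'r\<close> with a map \<open>\<phi>\<close> onto the field of \<open>p\<^sup>e\<close> elements and a filtration by ideals
  \<open>I k\<close>. The ideals play the role of the powers of \<open>p\<close> in the unramified extension of degree \<open>e\<close> of
  the \<open>p\<close>-adic integers: they are multiplicative, \<open>I 1\<close> is the kernel of \<open>\<phi>\<close> and contains \<open>p\<close>, and
  an integer in \<open>I k\<close> is divisible by \<open>p\<^sup>k\<close>. Working modulo \<open>I k\<close> avoids quotients and completions.
\<close>

locale adic_lift =
  fixes I :: "nat \<Rightarrow> 'r::comm_ring_1 set" and \<phi> :: "'r \<Rightarrow> 'a::{field,finite}" and p e :: nat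
  assumes prime_p: "prime p" and card_field: "CARD('a) = p ^ e"
    and I_add: "\<And>k x y. x \<in> I k \<Longrightarrow> y \<in> I k \<Longrightarrow> x + y \<in> I k"
    and I_mult: "\<And>k l x y. x \<in> I k \<Longrightarrow> y \<in> I l \<Longrightarrow> x * y \<in> I (k + l)"
    and I_0: "I 0 = UNIV"
    and I_Suc: "\<And>k. I (Suc k) \<subseteq> I k"
    and p_in_I: "of_nat p \<in> I 1"
    and of_nat_in_I: "\<And>N k. of_nat N \<in> I k \<Longrightarrow> p ^ k dvd N"
    and hom_add: "\<And>x y. \<phi> (x + y) = \<phi> x + \<phi> y"
    and hom_mult: "\<And>x y. \<phi> (x * y) = \<phi> x * \<phi> y"
    and hom_1: "\<phi> 1 = 1"
    and kernel: "\<And>x. \<phi> x = 0 \<longleftrightarrow> x \<in> I 1"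
    and surj_hom: "surj \<phi>"

text \<open>
  The ring is that of the integer polynomials, \<open>\<phi>\<close> evaluates at a generator \<open>\<theta>\<close> of the multiplicative
  group, and \<open>I k\<close> is the ideal generated by \<open>p\<^sup>k\<close> and \<open>h\<close>, where \<open>h\<close> is a monic integer polynomial of
  least degree vanishing at \<open>\<theta>\<close>. Minimality of the degree gives \<open>I 1\<close> as the kernel, and division
  by the monic polynomial \<open>h\<close> gives the divisibility of the integers in \<open>I k\<close>.
\<close>

lemma adic_lift_exists:
  assumes p: "prime p" and card: "CARD('a::{field,finite}) = p ^ e"
  shows "\<exists>(I :: nat \<Rightarrow> int poly set) (\<phi> :: int poly \<Rightarrow> 'a). adic_lift I \<phi> p e"
proof -
  have "(\<Sum>x\<in>UNIV. x + 1) = (\<Sum>x\<in>UNIV. x :: 'a)"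
    by (rule sum.reindex_bij_witness[of _ "\<lambda>x. x - 1" "\<lambda>x. x + 1"]) auto
  then have "of_nat CARD('a) = (0 :: 'a)" by (simp add: sum.distrib)
  \<comment> \<open>A power of \<open>p\<close> vanishes in the field, hence so does \<open>p\<close>.\<close>
  then have char: "of_nat p = (0 :: 'a)" by (simp add: card)
  obtain \<theta> :: 'a where \<theta>: "\<theta> \<noteq> 0" "\<And>x. x \<noteq> 0 \<Longrightarrow> \<exists>i. x = \<theta> ^ i"
    using finite_field_has_generator by blast
  define P where "P h \<longleftrightarrow> lead_coeff h = 1 \<and> poly_at \<theta> h = 0" for h :: "int poly"
  have "P (monom 1 CARD('a) - monom 1 1)"
  proof -
    have c: "CARD('a) > 1"
      using card_mono[of "UNIV :: 'a set" "{0,1}"] by simp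
    then have "degree (monom (1::int) CARD('a) - monom 1 1) = CARD('a)"
      using degree_add_eq_left[of "- monom 1 1" "monom (1::int) CARD('a)"] by (simp add: degree_monom_eq)
    then show ?thesis
      using c by (simp add: P_def finite_field_power_card)
  qed
  then obtain h where h: "P h" and h_min: "\<And>g. degree g < degree h \<Longrightarrow> \<not> P g"
    using exists_least_iff[of "\<lambda>n. \<exists>h. degree h = n \<and> P h"] by metis
  have monic: "lead_coeff h = 1" and root: "poly_at \<theta> h = 0" using h by (auto simp: P_def)
  have h0: "h \<noteq> 0" using monic by auto
  have "degree h \<noteq> 0"
  proof
    assume "degree h = 0"
    then obtain c where "h = [:c:]" by (rule degree_eq_zeroE)
    then show False using monic root by simp
  qed
  have division: "\<exists>s r. f = h * s + r \<and> degree r < degree h" for f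
  proof -
    obtain s r where sr: "pseudo_divmod f h = (s, r)" by force
    show ?thesis
      using pseudo_divmod[OF h0 sr] monic \<open>degree h \<noteq> 0\<close>
      by (intro exI[of _ s] exI[of _ r]) auto
  qed
  have p_vanish: "of_int (int p) = (0::'a)" using char by simp
  \<comment> \<open>A polynomial of degree below that of \<open>h\<close> vanishing at \<open>\<theta>\<close> is zero modulo \<open>p\<close>: strip
    leading terms divisible by \<open>p\<close>; a leading coefficient prime to \<open>p\<close> could be made 1, against
    the minimality of \<open>h\<close>.\<close>
  have small: "\<exists>s. r = smult (int p) s" if "degree r < degree h" "poly_at \<theta> r = 0" for r
    using that
  proof (induction "degree r" arbitrary: r rule: less_induct)
    case less
    show ?case
    proof (cases "int p dvd lead_coeff r")
      case True
      then obtain c where c: "lead_coeff r = int p * c" by auto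
      define r' where "r' = r - monom (lead_coeff r) (degree r)"
      have r: "r = r' + smult (int p) (monom c (degree r))"
        by (simp add: r'_def c smult_monom)
      have "poly_at \<theta> r' = 0"
        using less.prems by (simp add: r'_def c char)
      show ?thesis
      proof (cases "r' = 0")
        case False
        have "coeff r' (degree r) = 0" by (simp add: r'_def)
        moreover have "degree r' \<le> degree r"
          unfolding r'_def by (intro degree_diff_le) (auto simp: degree_monom_le)
        ultimately have "degree r' < degree r"
          using False by (metis leading_coeff_0_iff le_neq_implies_less)
        then obtain s where "r' = smult (int p) s"
          using less \<open>poly_at \<theta> r' = 0\<close> by (meson less_trans)
        then show ?thesis using r by (metis smult_add_right)
      qed (use r in auto)
    next
      case False
      then have "coprime (lead_coeff r) (int p)"
        using p by (simp add: coprime_commute prime_imp_coprime)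
      then obtain b where b: "[lead_coeff r * b = 1] (mod int p)"
        using cong_solve_coprime_int by blast
      then obtain c where c: "lead_coeff r * b + int p * c = 1"
        by (metis cong_iff_lin cong_sym)
      define g where "g = smult b r + smult (int p) (monom c (degree r))"
      have "coeff g (degree r) = 1" using c by (simp add: g_def mult.commute)
      moreover have "degree g \<le> degree r"
        unfolding g_def by (intro degree_add_le) (auto intro: degree_smult_le[THEN order_trans] simp: degree_monom_le)
      ultimately have "degree g = degree r"
        by (metis le_antisym le_degree zero_neq_one)
      then have "P g"
        using \<open>coeff g (degree r) = 1\<close> less.prems
        by (simp add: P_def) (simp add: g_def char)
      then show ?thesis using h_min \<open>degree g = degree r\<close> less.prems by metis
    qed
  qed
  define I where "I k = {smult (int p ^ k) a + h * b | a b. True}" for k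
  have I_iff: "x \<in> I k \<longleftrightarrow> (\<exists>a b. x = smult (int p ^ k) a + h * b)" for x k
    by (auto simp: I_def)
  have "adic_lift I (poly_at \<theta>) p e"
  proof
    show "prime p" "CARD('a) = p ^ e" by fact+
    show "x + y \<in> I k" if "x \<in> I k" "y \<in> I k" for k x y
    proof -
      obtain a b a' b' where "x = smult (int p ^ k) a + h * b" "y = smult (int p ^ k) a' + h * b'"
        using \<open>x \<in> I k\<close> \<open>y \<in> I k\<close> unfolding I_iff by blast
      then have "x + y = smult (int p ^ k) (a + a') + h * (b + b')"
        by (simp add: smult_add_right algebra_simps)
      then show ?thesis unfolding I_iff by blast
    qed
    show "x * y \<in> I (k + l)" if "x \<in> I k" "y \<in> I l" for k l x y
    proof -
      obtain a b a' b' where xy: "x = smult (int p ^ k) a + h * b" "y = smult (int p ^ l) a' + h * b'"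
        using \<open>x \<in> I k\<close> \<open>y \<in> I l\<close> unfolding I_iff by blast
      have "x * y = smult (int p ^ (k + l)) (a * a') +
          h * (b * y + smult (int p ^ k) (a * b'))"
        unfolding xy by (simp add: algebra_simps power_add smult_add_right)
      then show ?thesis unfolding I_iff by blast
    qed
    show "I 0 = UNIV"
    proof -
      have "x \<in> I 0" for x unfolding I_iff by (rule exI[of _ x], rule exI[of _ 0]) simp
      then show ?thesis by auto
    qed
    show "I (Suc k) \<subseteq> I k" for k
    proof
      fix x assume "x \<in> I (Suc k)"
      then obtain a b where "x = smult (int p ^ k) (smult (int p) a) + h * b"
        unfolding I_iff by (auto simp: mult.commute)
      then show "x \<in> I k" unfolding I_iff by blast
    qed
    show "of_nat p \<in> I 1"
      unfolding I_iff by (rule exI[of _ 1], rule exI[of _ 0]) (simp add: of_nat_poly)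
    show "p ^ k dvd N" if "of_nat N \<in> I k" for N k
    proof -
      obtain a b where ab: "of_nat N = smult (int p ^ k) a + h * b"
        using \<open>of_nat N \<in> I k\<close> unfolding I_iff by blast
      obtain s r where sr: "a = h * s + r" "degree r < degree h" using division by blast
      have eq: "of_nat N - smult (int p ^ k) r = h * (b + smult (int p ^ k) s)"
        using ab sr by (simp add: algebra_simps smult_add_right)
      have "degree (of_nat N - smult (int p ^ k) r) < degree h"
        using sr \<open>degree h \<noteq> 0\<close> by (intro degree_diff_less) (auto intro: le_less_trans[OF degree_smult_le])
      then have "b + smult (int p ^ k) s = 0"
        unfolding eq using h0 by (metis degree_mult_eq not_add_less1)
      then have "of_nat N = smult (int p ^ k) r" using eq by simp
      then have "int N = int p ^ k * coeff r 0"
        by (metis coeff_smult of_nat_poly coeff_pCons_0)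
      then have "int (p ^ k) dvd int N" by simp
      then show ?thesis by (simp only: of_nat_dvd_iff)
    qed
    show "poly_at \<theta> x = 0 \<longleftrightarrow> x \<in> I 1" for x
    proof
      assume "poly_at \<theta> x = 0"
      obtain s r where sr: "x = h * s + r" "degree r < degree h" using division by blast
      then have "poly_at \<theta> r = 0" using \<open>poly_at \<theta> x = 0\<close> root by simp
      then obtain a where "r = smult (int p) a" using small sr by blast
      then show "x \<in> I 1" unfolding I_iff using sr by (metis add.commute power_one_right)
    next
      assume "x \<in> I 1"
      then show "poly_at \<theta> x = 0"
        unfolding I_iff using root p_vanish by auto
    qed
    show "surj (poly_at \<theta>)"
      unfolding surj_def
    proof
      fix x :: 'a
      show "\<exists>f. x = poly_at \<theta> f"
      proof (cases "x = 0")
        case True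
        then show ?thesis by (intro exI[of _ 0]) simp
      next
        case False
        then obtain i where "x = \<theta> ^ i" using \<theta> by blast
        then show ?thesis by (intro exI[of _ "monom 1 i"]) simp
      qed
    qed
  qed simp_all
  then show ?thesis by blast
qed

section \<open>Counting zeros modulo powers of p\<close>

lemma sum_vec_prod:
  fixes h :: "'n::finite \<Rightarrow> 'a::finite \<Rightarrow> 'r::comm_ring_1"
  shows "(\<Sum>x\<in>(UNIV :: ('a ^ 'n) set). \<Prod>i\<in>UNIV. h i (x $ i)) = (\<Prod>i\<in>UNIV. \<Sum>a\<in>UNIV. h i a)"
proof -
  have "(\<Prod>i\<in>UNIV. \<Sum>a\<in>UNIV. h i a) = (\<Sum>g\<in>UNIV \<rightarrow>\<^sub>E UNIV. \<Prod>i\<in>UNIV. h i (g i))"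
    by (rule prod_sum_PiE) auto
  also have "\<dots> = (\<Sum>x\<in>(UNIV :: ('a ^ 'n) set). \<Prod>i\<in>UNIV. h i (x $ i))"
    by (rule sum.reindex_bij_witness[of _ vec_nth vec_lambda]) auto
  finally show ?thesis by simp
qed

context adic_lift
begin

lemma e_pos: "e > 0"
proof -
  have "CARD('a) > 1" using card_mono[of "UNIV :: 'a set" "{0,1}"] by simp
  then show ?thesis using card_field by (cases e) auto
qed

lemma I_scale: "x \<in> I k \<Longrightarrow> a * x \<in> I k"
  using I_mult[of a 0 x k] I_0 by simp

lemma I_scale_right: "x \<in> I k \<Longrightarrow> x * a \<in> I k"
  using I_scale[of x k a] by (simp add: mult.commute)

lemma p_power_in_I: "of_nat p ^ k \<in> I k"
proof (induction k)
  case (Suc k)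
  show ?case using I_mult[OF p_in_I Suc] by simp
qed (simp add: I_0)

lemma I_zero: "0 \<in> I k"
  using I_scale[OF p_power_in_I, of 0] by simp

lemma I_diff: "x \<in> I k \<Longrightarrow> y \<in> I k \<Longrightarrow> x - y \<in> I k"
  using I_add[of x k "- 1 * y"] I_scale[of y k "- 1"] by simp

lemma I_sum: "(\<And>i. i \<in> A \<Longrightarrow> x i \<in> I k) \<Longrightarrow> sum x A \<in> I k"
  by (induction A rule: infinite_finite_induct) (auto intro: I_zero I_add)

lemma I_antimono: "l \<le> k \<Longrightarrow> I k \<subseteq> I l"
  using lift_Suc_antimono_le[of I l k] I_Suc by simp

lemma I_power: "x \<in> I k \<Longrightarrow> x ^ n \<in> I (n * k)"
  by (induction n) (auto simp: I_0 intro: I_mult)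

lemma hom_0: "\<phi> 0 = 0"
  by (simp add: kernel I_zero)

lemma hom_diff: "\<phi> (x - y) = \<phi> x - \<phi> y"
  using hom_add[of "x - y" y] by simp

lemma hom_power: "\<phi> (x ^ n) = \<phi> x ^ n"
  by (induction n) (simp_all add: hom_1 hom_mult)

lemma hom_sum: "\<phi> (sum x A) = (\<Sum>i\<in>A. \<phi> (x i))"
  by (induction A rule: infinite_finite_induct) (simp_all add: hom_0 hom_add)

lemma hom_prod: "\<phi> (prod x A) = (\<Prod>i\<in>A. \<phi> (x i))"
  by (induction A rule: infinite_finite_induct) (simp_all add: hom_1 hom_mult)

lemma hom_of_nat: "\<phi> (of_nat n) = of_nat n"
  by (induction n) (simp_all add: hom_0 hom_add hom_1)

lemma hom_eq_iff: "\<phi> x = \<phi> y \<longleftrightarrow> x - y \<in> I 1"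
  by (simp only: kernel[symmetric] hom_diff right_minus_eq)

lemma diff_in_I_1: "\<phi> x = \<phi> y \<Longrightarrow> x - y \<in> I 1"
  by (simp only: hom_eq_iff)

lemma of_nat_dvd_in_I: "p ^ k dvd N \<Longrightarrow> of_nat N \<in> I k"
  using I_scale_right[OF p_power_in_I] by (auto elim!: dvdE)

lemma power_diff_in_I: "x - y \<in> I k \<Longrightarrow> x ^ n - y ^ n \<in> I k"
  unfolding power_diff_sumr2 by (rule I_scale_right)

text \<open>
  If \<open>x\<close> and \<open>y\<close> agree modulo \<open>I (Suc k)\<close>, the cofactor of \<open>x - y\<close> in \<open>x\<^sup>p - y\<^sup>p\<close> reduces to
  \<open>p y\<^sup>(\<^sup>p\<^sup>-\<^sup>1\<^sup>) = 0\<close> in the field, which gains one step of the filtration.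
\<close>

lemma power_p_diff_in_I:
  assumes "x - y \<in> I (Suc k)"
  shows "x ^ p - y ^ p \<in> I (Suc (Suc k))"
proof -
  define S where "S = (\<Sum>i<p. y ^ (p - Suc i) * x ^ i)"
  have "x - y \<in> I 1" using assms I_antimono[of 1 "Suc k"] by auto
  then have eq: "\<phi> x = \<phi> y" by (simp add: hom_eq_iff)
  have "\<phi> S = (\<Sum>i<p. \<phi> y ^ (p - 1))"
    unfolding S_def hom_sum hom_mult hom_power eq
    by (intro sum.cong) (auto simp flip: power_add)
  also have "\<dots> = 0"
    using kernel[of "of_nat p"] p_in_I by (simp add: hom_of_nat)
  finally have "S \<in> I 1" by (simp add: kernel)
  from I_mult[OF assms this] show ?thesis
    unfolding power_diff_sumr2 S_def by simp
qed

lemma power_p_power_diff_in_I: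
  assumes "x - y \<in> I 1"
  shows "x ^ (p ^ k) - y ^ (p ^ k) \<in> I (Suc k)"
proof (induction k)
  case (Suc k)
  from power_p_diff_in_I[OF this] show ?case
    by (simp add: mult.commute flip: power_mult)
qed (use assms in simp)

text \<open>
  An arbitrary set-theoretic section of \<open>\<phi>\<close>.
\<close>

definition lift :: "'a \<Rightarrow> 'r" where
  "lift = inv_into UNIV \<phi>"

lemma hom_lift [simp]: "\<phi> (lift a) = a"
  unfolding lift_def by (rule surj_f_inv_f[OF surj_hom])

text \<open>
  Elements outside \<open>I 1\<close> are invertible modulo every \<open>I k\<close>.
\<close>

lemma I_cancel:
  assumes x: "\<phi> x \<noteq> 0" and xs: "x * s \<in> I k"
  shows "s \<in> I k"
proof -
  define y where "y = lift (inverse (\<phi> x))"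
  have "x * y - 1 \<in> I 1"
    using x by (intro diff_in_I_1) (simp add: hom_mult hom_1 y_def)
  then have "(x * y) ^ (p ^ k) - 1 ^ (p ^ k) \<in> I (Suc k)"
    by (rule power_p_power_diff_in_I)
  then have *: "(x * y) ^ (p ^ k) - 1 \<in> I k" using I_Suc by auto
  have "p ^ k = Suc (p ^ k - 1)"
    using prime_gt_0_nat[OF prime_p] by simp
  then have "(x * y) ^ (p ^ k) = x * y * (x * y) ^ (p ^ k - 1)"
    by (metis power_Suc)
  then have "s = x * s * (y * (x * y) ^ (p ^ k - 1)) - s * ((x * y) ^ (p ^ k) - 1)"
    by (simp add: algebra_simps)
  then show ?thesis
    using I_diff[OF I_scale_right[OF xs] I_scale[OF *]] by metis
qed

text \<open>
  A Teichmueller representative to precision \<open>k\<close>: a lift of \<open>a\<close> that is multiplicative in \<open>a\<close> only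
  modulo \<open>I k\<close>. The exponent is a power of \<open>p\<^sup>e\<close>, hence it fixes the residue \<open>a\<close>.
\<close>

definition teich :: "nat \<Rightarrow> 'a \<Rightarrow> 'r" where
  "teich k a = lift a ^ (p ^ (e * k))"

lemma hom_teich [simp]: "\<phi> (teich k a) = a"
proof -
  have "a ^ (p ^ (e * k)) = a"
  proof (induction k)
    case (Suc k)
    have "a ^ (p ^ (e * Suc k)) = (a ^ (p ^ (e * k))) ^ CARD('a)"
      by (simp add: card_field power_add mult.commute flip: power_mult)
    then show ?case using Suc finite_field_power_card[of a] by simp
  qed simp
  then show ?thesis by (simp add: teich_def hom_power)
qed

lemma teich_mult: "teich k a * teich k b - teich k (a * b) \<in> I k"
proof -
  have "lift a * lift b - lift (a * b) \<in> I 1"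
    by (rule diff_in_I_1) (simp add: hom_mult)
  from power_p_power_diff_in_I[OF this, of "e * k"]
  have "teich k a * teich k b - teich k (a * b) \<in> I (Suc (e * k))"
    by (simp add: teich_def power_mult_distrib)
  moreover have "k \<le> Suc (e * k)" using e_pos by (cases e) auto
  ultimately show ?thesis using I_antimono by blast
qed

lemma sum_teich_power_in_I:
  assumes "\<not> p ^ e - 1 dvd u"
  shows "(\<Sum>a\<in>UNIV. teich k a ^ u) \<in> I k"
proof -
  obtain g :: 'a where g: "g \<noteq> 0" "\<And>x. x \<noteq> 0 \<Longrightarrow> \<exists>i::nat. x = g ^ i"
    using finite_field_has_generator by blast
  define S where "S = (\<Sum>a\<in>UNIV. teich k a ^ u)"
  have "g ^ u \<noteq> 1"
    using generator_power_eq_1_imp_dvd[OF g, of u] assms card_field by auto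
  then have ne: "\<phi> (teich k g ^ u - 1) \<noteq> 0"
    by (simp add: hom_diff hom_power hom_1)
  \<comment> \<open>Substituting \<open>g a\<close> for \<open>a\<close> multiplies the sum by \<open>teich k g ^ u\<close>, which differs from 1
    in the residue field.\<close>
  have "S = (\<Sum>a\<in>UNIV. teich k (g * a) ^ u)"
    unfolding S_def
    by (rule sum.reindex_bij_witness[of _ "\<lambda>a. g * a" "\<lambda>a. a / g"]) (use g in auto)
  then have "(teich k g ^ u - 1) * S = (\<Sum>a\<in>UNIV. (teich k g * teich k a) ^ u - teich k (g * a) ^ u)"
    by (simp add: left_diff_distrib sum_subtractf power_mult_distrib flip: sum_distrib_left)
       (simp add: S_def)
  also have "\<dots> \<in> I k"
    by (intro I_sum power_diff_in_I teich_mult)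
  finally show ?thesis using I_cancel[OF ne] S_def by simp
qed

text \<open>
  The power with exponent \<open>(p\<^sup>e - 1) p\<^sup>k\<close> is, modulo \<open>I k\<close>, the indicator of a nonzero residue. This
  exponent also has the small digit sum \<open>e (p - 1)\<close>, which keeps the multinomial coefficients of the
  expansion highly divisible.
\<close>

lemma power_indicator:
  fixes x :: 'r
  shows "x ^ ((p ^ e - 1) * p ^ k) - (if \<phi> x = 0 then 0 else 1) \<in> I k"
proof (cases "\<phi> x = 0")
  case True
  have "x ^ ((p ^ e - 1) * p ^ k) \<in> I ((p ^ e - 1) * p ^ k)"
    using I_power[of x 1] True by (simp add: kernel)
  moreover have "k \<le> (p ^ e - 1) * p ^ k"
  proof -
    have "k \<le> 1 * p ^ k"
      using less_exp[of k] power_mono[of 2 p k] prime_ge_2_nat[OF prime_p] by simp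
    also have "\<dots> \<le> (p ^ e - 1) * p ^ k"
      using prime_ge_2_nat[OF prime_p] e_pos one_less_power[of p e] by (intro mult_le_mono1) simp
    finally show ?thesis .
  qed
  ultimately show ?thesis using True I_antimono by auto
next
  case False
  have "\<phi> x ^ (p ^ e - 1) = 1"
    using finite_field_power_card_minus_1[OF False] by (simp add: card_field)
  then have "x ^ (p ^ e - 1) - 1 \<in> I 1"
    by (intro diff_in_I_1) (simp add: hom_power hom_1)
  from power_p_power_diff_in_I[OF this, of k] False show ?thesis
    using I_Suc by (auto simp: power_mult)
qed

text \<open>
  The assumption \<open>weights\<close> is the divisibility of every surviving term of the multinomial expansion;
  the bound on \<open>k\<close> takes care of the sum of the constant 1 over all points.
\<close>

lemma num_zeros_dvd:
  fixes f :: "('n::finite, 'a) mpolynomial"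
  assumes k: "k \<le> e * CARD('n)"
    and weights: "\<And>m. m \<in> compositions (Poly_Mapping.keys f) ((p ^ e - 1) * p ^ k) \<Longrightarrow>
      (\<And>i. p ^ e - 1 dvd (\<Sum>j\<in>Poly_Mapping.keys f. m j * Poly_Mapping.lookup j i)) \<Longrightarrow>
      p ^ k dvd multinomial (Poly_Mapping.keys f) m *
        (p ^ e) ^ card {i. (\<Sum>j\<in>Poly_Mapping.keys f. m j * Poly_Mapping.lookup j i) = 0}"
  shows "p ^ k dvd num_zeros f"
proof -
  define M where "M = (p ^ e - 1) * p ^ k"
  define J where "J = Poly_Mapping.keys f"
  define u where "u m i = (\<Sum>j\<in>J. m j * Poly_Mapping.lookup j i)" for m and i :: 'n
  define c where "c j = lift (Poly_Mapping.lookup f j)" for j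
  define F where "F x = (\<Sum>j\<in>J. c j * (\<Prod>i\<in>UNIV. teich k (x $ i) ^ Poly_Mapping.lookup j i))" for x :: "'a ^ 'n"
  have J: "finite J" by (simp add: J_def)
  have hom_F: "\<phi> (F x) = poly_eval f x" for x
    by (simp add: F_def hom_sum hom_mult hom_prod hom_power c_def poly_eval_def J_def)
  have "of_nat (num_zeros f) = (\<Sum>x\<in>UNIV. if poly_eval f x = 0 then 1 else (0::'r))"
    by (simp add: num_zeros_def sum.If_cases)
  also have "\<dots> = (\<Sum>x\<in>UNIV. 1 - (if \<phi> (F x) = 0 then 0 else 1))"
    unfolding hom_F by (intro sum.cong) auto
  finally have "of_nat (num_zeros f) - (\<Sum>x\<in>UNIV. 1 - F x ^ M)
      = (\<Sum>x\<in>UNIV. F x ^ M - (if \<phi> (F x) = 0 then 0 else 1))"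
    by (simp add: sum_subtractf)
  also have "\<dots> \<in> I k"
    unfolding M_def by (intro I_sum power_indicator)
  finally have count: "of_nat (num_zeros f) - (\<Sum>x\<in>UNIV. 1 - F x ^ M) \<in> I k" .
  define S where "S v = (\<Sum>a\<in>UNIV. teich k a ^ v)" for v
  have summand: "of_nat (multinomial J m) * (\<Prod>j\<in>J. c j ^ m j) * (\<Prod>i\<in>UNIV. S (u m i)) \<in> I k"
    if m: "m \<in> compositions J M" for m
  proof (cases "\<forall>i. p ^ e - 1 dvd u m i")
    case False
    then obtain i where "\<not> p ^ e - 1 dvd u m i" by blast
    then have "S (u m i) \<in> I k" unfolding S_def by (rule sum_teich_power_in_I)
    then have "S (u m i) * (\<Prod>i\<in>UNIV - {i}. S (u m i)) \<in> I k" by (rule I_scale_right)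
    then have "(\<Prod>i\<in>UNIV. S (u m i)) \<in> I k"
      by (subst prod.remove[of UNIV i]) auto
    then show ?thesis by (rule I_scale)
  next
    case True
    define Z where "Z = {i. u m i = 0}"
    \<comment> \<open>A coordinate with exponent 0 contributes 1 for every field element, including 0.\<close>
    have S0: "S 0 = of_nat (p ^ e)" by (simp add: S_def card_field)
    have "(\<Prod>i\<in>UNIV. S (u m i)) = (\<Prod>i\<in>Z. S (u m i)) * (\<Prod>i\<in>-Z. S (u m i))"
      by (subst prod.union_disjoint[symmetric]) (auto simp: Un_commute)
    also have "(\<Prod>i\<in>Z. S (u m i)) = (\<Prod>i\<in>Z. of_nat (p ^ e))"
      by (intro prod.cong) (auto simp: Z_def S0)
    also have "\<dots> = of_nat ((p ^ e) ^ card Z)" by simp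
    finally have "of_nat (multinomial J m) * (\<Prod>j\<in>J. c j ^ m j) * (\<Prod>i\<in>UNIV. S (u m i))
       = of_nat (multinomial J m * (p ^ e) ^ card Z) * ((\<Prod>j\<in>J. c j ^ m j) * (\<Prod>i\<in>-Z. S (u m i)))"
      by (simp only: of_nat_mult mult_ac)
    moreover have "of_nat (multinomial J m * (p ^ e) ^ card Z) \<in> I k"
      using weights[of m] m True unfolding Z_def u_def J_def M_def by (intro of_nat_dvd_in_I) blast
    ultimately show ?thesis by (simp only: I_scale_right)
  qed
  have monomials: "(\<Prod>j\<in>J. (c j * (\<Prod>i\<in>UNIV. teich k (x $ i) ^ Poly_Mapping.lookup j i)) ^ m j)
      = (\<Prod>j\<in>J. c j ^ m j) * (\<Prod>i\<in>UNIV. teich k (x $ i) ^ u m i)" for m and x :: "'a ^ 'n"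
  proof -
    have "(\<Prod>j\<in>J. (\<Prod>i\<in>UNIV. teich k (x $ i) ^ Poly_Mapping.lookup j i) ^ m j)
       = (\<Prod>j\<in>J. \<Prod>i\<in>UNIV. teich k (x $ i) ^ (m j * Poly_Mapping.lookup j i))"
      by (simp add: prod_power_distrib mult.commute flip: power_mult)
    also have "\<dots> = (\<Prod>i\<in>UNIV. teich k (x $ i) ^ u m i)"
      by (subst prod.swap) (simp add: u_def power_sum)
    finally show ?thesis by (simp add: power_mult_distrib prod.distrib)
  qed
  have "(\<Sum>x\<in>UNIV. F x ^ M) = (\<Sum>x\<in>UNIV. \<Sum>m\<in>compositions J M.
      of_nat (multinomial J m) * (\<Prod>j\<in>J. c j ^ m j) * (\<Prod>i\<in>UNIV. teich k (x $ i) ^ u m i))"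
    unfolding F_def multinomial_theorem[OF J] monomials by (simp only: mult.assoc)
  also have "\<dots> = (\<Sum>m\<in>compositions J M.
      of_nat (multinomial J m) * (\<Prod>j\<in>J. c j ^ m j) * (\<Prod>i\<in>UNIV. S (u m i)))"
    by (subst sum.swap)
       (simp only: sum_distrib_left[symmetric] S_def sum_vec_prod[where h = "\<lambda>i a. teich k a ^ u _ i"])
  also have "\<dots> \<in> I k" by (intro I_sum summand)
  finally have powers: "(\<Sum>x\<in>UNIV. F x ^ M) \<in> I k" .
  have "p ^ k dvd CARD('a ^ 'n)"
    using k by (simp add: card_field le_imp_power_dvd flip: power_mult)
  then have "(\<Sum>x\<in>(UNIV :: ('a ^ 'n) set). 1) \<in> I k"
    using of_nat_dvd_in_I[of k "CARD('a ^ 'n)"] by (simp only: sum_constant mult_1_right)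
  from I_add[OF count I_diff[OF this powers]] have "of_nat (num_zeros f) \<in> I k"
    by (simp add: sum_subtractf)
  then show ?thesis by (rule of_nat_in_I)
qed

end

section \<open>Divisibility of the surviving terms\<close>

text \<open>
  The bound on the least dilation is applied to each of the \<open>e\<close> cyclic shifts of the weights \<open>m\<close>. They
  all have the same zero coordinates \<open>Z\<close>, and the sum of the resulting inequalities is a bound on the
  digit sums, that is, on the valuation of the multinomial coefficient.
\<close>

lemma multinomial_divisible:
  fixes J :: "('n::finite \<Rightarrow>\<^sub>0 nat) set" and m :: "('n \<Rightarrow>\<^sub>0 nat) \<Rightarrow> nat"
  assumes p: "prime p" and e: "e > 0" and J: "finite J"
    and occurs: "\<And>c. \<exists>j\<in>J. Poly_Mapping.lookup j c > 0"
    and total: "sum m J = (p ^ e - 1) * p ^ k"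
    and coords: "\<And>c. p ^ e - 1 dvd (\<Sum>j\<in>J. m j * Poly_Mapping.lookup j c)"
  defines "Z \<equiv> {c. (\<Sum>j\<in>J. m j * Poly_Mapping.lookup j c) = 0}"
  shows "p ^ (e * (least_dilation p (append_one ` J) - 1)) dvd multinomial J m * (p ^ e) ^ card Z"
proof -
  have p2: "p \<ge> 2" using p by (rule prime_ge_2_nat)
  define d where "d = p ^ e - 1"
  define \<mu> where "\<mu> = least_dilation p (append_one ` J)"
  define v where "v = multiplicity p (multinomial J m)"
  have d0: "d > 0" using one_less_power[of p e] p2 e by (simp add: d_def)
  have cop: "coprime d p"
  proof -
    have "coprime (p ^ e - 1) (p ^ e)"
      using p2 by (intro coprime_diff_one_left_nat) simp
    then show ?thesis using e by (simp add: d_def)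
  qed
  \<comment> \<open>Every cyclic shift of the digits keeps the divisibility by \<open>d\<close> and the zero coordinates.\<close>
  have bound: "d * \<mu> \<le> (\<Sum>j\<in>J. cyclic_digits p e i (m j)) + d * card Z" for i
  proof -
    have dvd: "d dvd (\<Sum>j\<in>J. cyclic_digits p e i (m j) * g j)" if "d dvd (\<Sum>j\<in>J. m j * g j)" for g
    proof -
      have "[(\<Sum>j\<in>J. cyclic_digits p e i (m j) * g j) = (\<Sum>j\<in>J. p ^ i * m j * g j)] (mod d)"
        unfolding d_def by (intro cong_sum cong_mult cyclic_digits_cong p2 cong_refl)
      moreover have "(\<Sum>j\<in>J. p ^ i * m j * g j) = p ^ i * (\<Sum>j\<in>J. m j * g j)"
        by (simp add: sum_distrib_left mult.assoc)
      ultimately show ?thesis using that by (simp add: cong_dvd_iff)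
    qed
    have "Z = {c. (\<Sum>j\<in>J. cyclic_digits p e i (m j) * Poly_Mapping.lookup j c) = 0}"
      using J p2 by (simp add: Z_def cyclic_digits_eq_0_iff)
    moreover have "d dvd sum m J" using total by (simp add: d_def)
    ultimately show ?thesis
      using least_dilation_le_add_zeros[OF J d0 cop occurs, of "\<lambda>j. cyclic_digits p e i (m j)"]
        dvd[of "\<lambda>_. 1"] dvd coords
      by (simp add: d_def \<mu>_def)
  qed
  have geometric: "(p - 1) * (\<Sum>i<e. p ^ i) = d"
    using p2 power_diff_1_eq[of "int p" e]
    by (simp add: d_def of_nat_diff flip: of_nat_eq_iff[where ?'a = int])
  have "e * (d * \<mu>) = (\<Sum>i<e. d * \<mu>)" by simp
  also have "\<dots> \<le> (\<Sum>i<e. (\<Sum>j\<in>J. cyclic_digits p e i (m j)) + d * card Z)"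
    by (intro sum_mono bound)
  also have "\<dots> = (\<Sum>j\<in>J. \<Sum>i<e. cyclic_digits p e i (m j)) + e * (d * card Z)"
    by (subst sum.swap) (simp add: sum.distrib)
  also have "(\<Sum>j\<in>J. \<Sum>i<e. cyclic_digits p e i (m j)) = (\<Sum>j\<in>J. digit_sum p (m j)) * (\<Sum>i<e. p ^ i)"
    using sum_cyclic_digits[OF p2 e, of 0] by (simp add: sum_distrib_right)
  also have "(\<Sum>j\<in>J. digit_sum p (m j)) = (p - 1) * v + e * (p - 1)"
    using multinomial_multiplicity[OF p J, of m]
    by (simp only: v_def total digit_sum_mult_power[OF p2] digit_sum_power_minus_1[OF p2])
  also have "((p - 1) * v + e * (p - 1)) * (\<Sum>i<e. p ^ i) = d * (v + e)"
    unfolding geometric[symmetric] by (simp only: distrib_right distrib_left mult_ac)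
  finally have "d * (e * \<mu>) \<le> d * (v + e + e * card Z)"
    by (simp add: algebra_simps)
  then have "e * \<mu> \<le> v + e + e * card Z" using d0 by simp
  then have "e * (\<mu> - 1) \<le> v + e * card Z"
    by (simp add: diff_mult_distrib2)
  then have "p ^ (e * (\<mu> - 1)) dvd p ^ v * p ^ (e * card Z)"
    by (simp add: le_imp_power_dvd flip: power_add)
  also have "\<dots> dvd multinomial J m * (p ^ e) ^ card Z"
    unfolding v_def by (intro mult_dvd_mono multiplicity_dvd) (simp add: power_mult)
  finally show ?thesis unfolding \<mu>_def .
qed

section \<open>The valuation of the number of zeros\<close>

theorem theorem1p3:
  fixes p q e :: nat
    and f :: "('n::finite, 'a::{field,finite}) mpolynomial"
    and J :: "('n \<Rightarrow>\<^sub>0 nat) set"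
    and a :: "('n \<Rightarrow>\<^sub>0 nat) \<Rightarrow> 'a"
  assumes "prime p" and "0 < e" and "q = p ^ e" and "CARD('a) = q"
    and "finite J" and "\<And>j. j \<in> J \<Longrightarrow> a j \<noteq> 0"
    and "f = (\<Sum>j\<in>J. Poly_Mapping.single j (a j))"
    and "\<And>V. V \<subset> (UNIV :: 'n set) \<Longrightarrow> f \<notin> polys_in V"
  shows "ord_norm p q (num_zeros f) \<ge> ereal (real (least_dilation p (append_one ` J)) - 1)"
proof -
  define \<mu> where "\<mu> = least_dilation p (append_one ` J)"
  have "Poly_Mapping.lookup f j = (\<Sum>i\<in>J. if i = j then a i else 0)" for j
    by (simp add: assms(7) lookup_sum lookup_single when_def)
  then have coeff: "Poly_Mapping.lookup f j = (if j \<in> J then a j else 0)" for j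
    using assms(5) by (simp add: sum.delta)
  then have keys: "Poly_Mapping.keys f = J"
    using assms(6) by (auto simp: in_keys_iff split: if_splits)
  have occurs: "\<exists>j\<in>J. Poly_Mapping.lookup j c > 0" for c
  proof -
    have "f \<notin> polys_in (UNIV - {c})" by (rule assms(8)) auto
    then show ?thesis by (auto simp: polys_in_def keys in_keys_iff)
  qed
  have "\<mu> \<le> CARD('n)"
    using least_dilation_le_add_zeros[OF assms(5) _ _ occurs, of 1 p "\<lambda>_. 0"] by (simp add: \<mu>_def)
  then have k: "e * (\<mu> - 1) \<le> e * CARD('n)" by (intro mult_le_mono2) simp
  obtain I :: "nat \<Rightarrow> int poly set" and \<phi> :: "int poly \<Rightarrow> 'a" where "adic_lift I \<phi> p e"
    using adic_lift_exists[OF assms(1), of e, where ?'a = 'a] assms by auto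
  then interpret adic_lift I \<phi> p e .
  have dvd: "p ^ (e * (\<mu> - 1)) dvd num_zeros f"
  proof (rule num_zeros_dvd[OF k], unfold keys)
    fix m assume "m \<in> compositions J ((p ^ e - 1) * p ^ (e * (\<mu> - 1)))"
      and "\<And>i. p ^ e - 1 dvd (\<Sum>j\<in>J. m j * Poly_Mapping.lookup j i)"
    then show "p ^ (e * (\<mu> - 1)) dvd multinomial J m *
        (p ^ e) ^ card {i. (\<Sum>j\<in>J. m j * Poly_Mapping.lookup j i) = 0}"
      unfolding \<mu>_def compositions_def
      by (intro multinomial_divisible[OF assms(1,2,5) occurs]) auto
  qed
  show ?thesis
  proof (cases "num_zeros f = 0")
    case False
    then have "e * (\<mu> - 1) \<le> multiplicity p (num_zeros f)"
      using dvd assms(1) by (intro multiplicity_geI) auto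
    then have "real (e * (\<mu> - 1)) \<le> real (multiplicity p (num_zeros f))"
      by (simp only: of_nat_le_iff)
    then have "real (\<mu> - 1) \<le> real (multiplicity p (num_zeros f)) / real e"
      using assms(2) by (simp add: field_simps)
    moreover have "real \<mu> - 1 \<le> real (\<mu> - 1)" by simp
    ultimately show ?thesis
      using False assms(1,3) by (simp add: ord_norm_def \<mu>_def)
  qed (simp add: ord_norm_def)
qed

end
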